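(* For $n,k,r,q\in\mathbb{N}$, the numbers $\mu(n,k,r,q)$ satisfy the following. (i) If $n\geq k\geq r\geq q>0$ and $n\equiv k\pmod 2$, then $$\begin{aligned}\mu(n,k,r,q)=&(n-k)\,\mu(n-2,k,r,q)+\mu(n-1,k-1,r-1,q-1)+\mu(n-1,k-1,r-1,q)\\&+(k-r)\,\mu(n-2,k-2,r-1,q)+(r-1)\,\mu(n-2,k-2,r-2,q).\end{aligned}$$ (ii) If $n\geq k\geq r$ and $n\equiv k\pmod 2$, then $$\mu(n,k,r,0)=\sum_{i=0}^{\lfloor n/2\rfloor}\binom{n}{2i}(2i-1)!!.$$ (iii) $\mu(n,k,r,q)=0$ otherwise, i.e. whenever $(n,k,r,q)$ falls under neither (i) nor (ii) (with $q=0$ in case (ii)).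
   Context: $\mathbb{N}=\{0,1,2,\ldots\}$, $[n]=\{1,\ldots,n\}$, $[0]=\emptyset$, and $(-1)!!=1$. A 1-2-equivalence is an equivalence relation all of whose classes have size at most $2$. A PB-pair on a set $T$ is a pair $(\varepsilon,X)$ where $\varepsilon$ is a 1-2-equivalence on $T$ and $X\subseteq T$ is such that each element of $X$ belongs to a singleton $\varepsilon$-class. The join of PB-pairs $(\varepsilon_1,X_1)$ and $(\varepsilon_2,X_2)$ on $T$ is $(\varepsilon_1,X_1)\vee(\varepsilon_2,X_2)=(\varepsilon_1\vee\varepsilon_2,Z)$, where $Z=\{(x,y)\in X_1\times X_2: x \text{ and } y \text{ belong to the same class of } \varepsilon_1\vee\varepsilon_2\}$ and $\varepsilon_1\vee\varepsilon_2$ is the join in the lattice of equivalences; its rank is $|Z|$. For $m\in\mathbb{N}$ and $0\le k\le m$ with $k\equiv m\pmod 2$, $\varepsilon_{m,k}$ is the equivalence on $[m]$ with classes $\{1\},\ldots,\{k\},\{k+1,k+2\},\ldots,\{m-1,m\}$. For $m,k,t,q\in\mathbb{N}$, $\mu(m,k,t,q)$ is the number of PB-pairs $(\eta,X)$ on $[m]$ such that $|X|=q$ and $\operatorname{rank}((\varepsilon_{m,k},[t])\vee(\eta,X))=q$; if $\varepsilon_{m,k}$ is undefined or $(\varepsilon_{m,k},[t])$ is not a PB-pair on $[m]$, then $\mu(m,k,t,q)=0$. A term $\mu(\cdot)$ with a negative argument is read as $0$ (in (i) this occurs only with coefficient $0$). *)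

theory Defs
  imports "HOL-Number_Theory.Cong"
begin

text \<open>The conjunct \<open>finite C\<close> is needed because \<open>card\<close> is 0 on infinite sets.\<close>

definition one_two_equiv :: "'a set \<Rightarrow> ('a \<times> 'a) set \<Rightarrow> bool" where
  "one_two_equiv T \<epsilon> \<longleftrightarrow> equiv T \<epsilon> \<and> (\<forall>C \<in> T // \<epsilon>. finite C \<and> card C \<le> 2)"

definition PB_pair :: "'a set \<Rightarrow> ('a \<times> 'a) set \<times> 'a set \<Rightarrow> bool" where
  "PB_pair T p \<longleftrightarrow> (case p of (\<epsilon>, X) \<Rightarrow>
     one_two_equiv T \<epsilon> \<and> X \<subseteq> T \<and> (\<forall>x\<in>X. {x} \<in> T // \<epsilon>))"

definition equiv_join :: "'a set \<Rightarrow> ('a \<times> 'a) set \<Rightarrow> ('a \<times> 'a) set \<Rightarrow> ('a \<times> 'a) set" where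
  "equiv_join T \<epsilon>\<^sub>1 \<epsilon>\<^sub>2 = \<Inter> {\<theta>. equiv T \<theta> \<and> \<epsilon>\<^sub>1 \<subseteq> \<theta> \<and> \<epsilon>\<^sub>2 \<subseteq> \<theta>}"

lemma equiv_equiv_join:
  assumes "\<epsilon>\<^sub>1 \<subseteq> T \<times> T" "\<epsilon>\<^sub>2 \<subseteq> T \<times> T"
  shows "equiv T (equiv_join T \<epsilon>\<^sub>1 \<epsilon>\<^sub>2)"
proof -
  have "equiv T (T \<times> T)"
    by (auto simp: equiv_def refl_on_def sym_def trans_def)
  with assms have "equiv_join T \<epsilon>\<^sub>1 \<epsilon>\<^sub>2 \<subseteq> T \<times> T"
    unfolding equiv_join_def by blast
  moreover have "refl_on T (equiv_join T \<epsilon>\<^sub>1 \<epsilon>\<^sub>2)"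
    by (auto simp: equiv_join_def equiv_def refl_on_def)
  moreover have "sym (equiv_join T \<epsilon>\<^sub>1 \<epsilon>\<^sub>2)"
    by (auto simp: equiv_join_def equiv_def intro!: symI dest: symD)
  moreover have "trans (equiv_join T \<epsilon>\<^sub>1 \<epsilon>\<^sub>2)"
    by (rule transI) (auto simp: equiv_join_def equiv_def dest: transD)
  ultimately show ?thesis
    by (rule equivI)
qed

lemma equiv_join_upper:
  "\<epsilon>\<^sub>1 \<subseteq> equiv_join T \<epsilon>\<^sub>1 \<epsilon>\<^sub>2" "\<epsilon>\<^sub>2 \<subseteq> equiv_join T \<epsilon>\<^sub>1 \<epsilon>\<^sub>2"
  unfolding equiv_join_def by auto

lemma equiv_join_least:
  "equiv T \<theta> \<Longrightarrow> \<epsilon>\<^sub>1 \<subseteq> \<theta> \<Longrightarrow> \<epsilon>\<^sub>2 \<subseteq> \<theta> \<Longrightarrow> equiv_join T \<epsilon>\<^sub>1 \<epsilon>\<^sub>2 \<subseteq> \<theta>"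
  unfolding equiv_join_def by auto

definition PB_join ::
  "'a set \<Rightarrow> ('a \<times> 'a) set \<times> 'a set \<Rightarrow> ('a \<times> 'a) set \<times> 'a set \<Rightarrow> ('a \<times> 'a) set \<times> ('a \<times> 'a) set" where
  "PB_join T p\<^sub>1 p\<^sub>2 = (case (p\<^sub>1, p\<^sub>2) of ((\<epsilon>\<^sub>1, X\<^sub>1), (\<epsilon>\<^sub>2, X\<^sub>2)) \<Rightarrow>
     (let \<theta> = equiv_join T \<epsilon>\<^sub>1 \<epsilon>\<^sub>2 in (\<theta>, {(x, y) \<in> X\<^sub>1 \<times> X\<^sub>2. (x, y) \<in> \<theta>})))"

definition PB_rank :: "('a \<times> 'a) set \<times> ('a \<times> 'a) set \<Rightarrow> nat" where
  "PB_rank j = card (snd j)"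

text \<open>
  The equivalence \<open>\<epsilon>\<^bsub>m,k\<^esub>\<close> is given by its classes. It is only meaningful for \<open>k \<le> m\<close> and
  \<open>k \<equiv> m (mod 2)\<close>; \<open>\<mu>\<close> below tests these conditions separately.
\<close>

definition eps_classes :: "nat \<Rightarrow> nat \<Rightarrow> nat set set" where
  "eps_classes m k = {{i} | i. 1 \<le> i \<and> i \<le> k} \<union>
     {{k + 2 * j + 1, k + 2 * j + 2} | j. k + 2 * j + 2 \<le> m}"

definition eps :: "nat \<Rightarrow> nat \<Rightarrow> (nat \<times> nat) set" where
  "eps m k = {(x, y). \<exists>C \<in> eps_classes m k. x \<in> C \<and> y \<in> C}"

definition \<mu> :: "nat \<Rightarrow> nat \<Rightarrow> nat \<Rightarrow> nat \<Rightarrow> nat" where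
  "\<mu> m k t q =
     (if k \<le> m \<and> [k = m] (mod 2) \<and> PB_pair {1..m} (eps m k, {1..t})
      then card {(\<eta>, X). PB_pair {1..m} (\<eta>, X) \<and> card X = q \<and>
                         PB_rank (PB_join {1..m} (eps m k, {1..t}) (\<eta>, X)) = q}
      else 0)"

text \<open>Extension of \<open>\<mu>\<close> to integer arguments, read as 0 when an argument is negative.\<close>

definition \<mu>\<^sub>Z :: "int \<Rightarrow> int \<Rightarrow> int \<Rightarrow> int \<Rightarrow> int" where
  "\<mu>\<^sub>Z m k t q =
     (if m < 0 \<or> k < 0 \<or> t < 0 \<or> q < 0 then 0 else int (\<mu> (nat m) (nat k) (nat t) (nat q)))"

text \<open>The double factorial \<open>n!!\<close>, with the empty product 1 for \<open>n \<le> 0\<close>; in particular \<open>(-1)!! = 1\<close>.\<close>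

function double_fact :: "int \<Rightarrow> nat" where
  "double_fact n = (if n \<le> 0 then 1 else nat n * double_fact (n - 2))"
  by auto
termination by (relation "measure nat") auto

declare double_fact.simps [simp del]

end

theory Submission
  imports Defs
begin

text \<open>
  Regard the two-element classes of \<open>\<epsilon>\<close> and of \<open>\<eta>\<close> as edges of two colours on the same
  point set \<open>T\<close>; the classes of the join are the connected components. Fix \<open>\<epsilon>\<close> together with a
  set \<open>A\<close> of marked points that are singletons of \<open>\<epsilon>\<close>, and count the PB-pairs \<open>(\<eta>, X)\<close>, with
  \<open>|X| = q\<close>, for which the join has rank \<open>q\<close> (\<open>completions\<close>). Choose a marked point \<open>x\<close>. It
  carries no \<open>\<epsilon>\<close>-edge, so it is attached to the rest only by its \<open>\<eta>\<close>-class \<open>D\<close>, and deleting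
  \<open>D\<close> leaves a problem of the same kind.

  \<^item> If \<open>D = {x}\<close>, then \<open>x\<close> is a component. It contributes the pair \<open>(x, x)\<close> to the rank
    if \<open>x\<close> lies in \<open>X\<close>, and nothing otherwise.
  \<^item> If \<open>D = {x, y}\<close> with \<open>y\<close> a singleton of \<open>\<epsilon>\<close>, then \<open>D\<close> is a component disjoint from \<open>X\<close> and
    contributes nothing; \<open>y\<close> may be marked or unmarked.
  \<^item> If \<open>D = {x, y}\<close> and \<open>y\<close> has the \<open>\<epsilon>\<close>-partner \<open>z\<close>, then the path \<open>x, y, z\<close> is contracted to
    \<open>z\<close>. This point loses its \<open>\<epsilon>\<close>-edge and inherits the mark of \<open>x\<close>, and the rank is unchanged.

  With \<open>n\<close> points, \<open>k\<close> singletons of \<open>\<epsilon>\<close> and \<open>r\<close> marks, the number of choices of \<open>y\<close> is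
  \<open>k - r\<close> (unmarked singleton), \<open>r - 1\<close> (marked singleton) and \<open>n - k\<close> (non-singleton); these
  are the coefficients in the recurrence (\<open>completions_split\<close>, \<open>completions_recurrence\<close>).

  The deletion does not preserve the standard form of \<open>\<epsilon>\<close>, so the recurrence is proved for an
  arbitrary \<open>\<epsilon>\<close>. Its right-hand side refers only to the parameters \<open>(n, k, r, q)\<close>; hence, by
  induction on the number of points, so does the count itself, which is therefore \<open>\<mu> n k r q\<close>
  (\<open>card_completions_eq_\<mu>\<close>). No isomorphism between the reduced structure and the
  standard one has to be exhibited.

  For \<open>q = 0\<close> the rank condition is vacuous and all 1-2-equivalences on \<open>n\<close> points are counted,
  and deleting the class of a point gives the recurrence of the involution numbers. For \<open>q > r\<close>
  the same deletion shows by induction that there are no completions.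
\<close>

section \<open>1-2-equivalences and their singleton classes\<close>

definition singletons :: "'a set \<Rightarrow> ('a \<times> 'a) set \<Rightarrow> 'a set" where
  "singletons T \<epsilon> = {x \<in> T. \<epsilon> `` {x} = {x}}"

lemma one_two_equiv_iff:
  assumes "finite T"
  shows "one_two_equiv T \<epsilon> \<longleftrightarrow> equiv T \<epsilon> \<and> (\<forall>x\<in>T. card (\<epsilon> `` {x}) \<le> 2)"
proof -
  have "finite (\<epsilon> `` {x})" if "equiv T \<epsilon>" for x
    using that assms by (meson equiv_class_subset finite_subset equiv_type Image_subset)
  then show ?thesis
    unfolding one_two_equiv_def quotient_def by auto
qed

lemma PB_pair_iff:
  "PB_pair T (\<epsilon>, X) \<longleftrightarrow> one_two_equiv T \<epsilon> \<and> X \<subseteq> singletons T \<epsilon>"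
proof -
  have "{x} \<in> T // \<epsilon> \<longleftrightarrow> \<epsilon> `` {x} = {x}" if "equiv T \<epsilon>" "x \<in> T" for x
    using that by (metis equiv_class_self quotientE quotientI singletonD)
  then show ?thesis
    unfolding PB_pair_def singletons_def one_two_equiv_def by auto
qed

lemma PB_pair_subset:
  assumes "PB_pair T (\<epsilon>, X)"
  shows "\<epsilon> \<subseteq> T \<times> T" "X \<subseteq> T"
proof -
  have "equiv T \<epsilon>" "X \<subseteq> singletons T \<epsilon>"
    using assms unfolding PB_pair_iff one_two_equiv_def by blast+
  then show "\<epsilon> \<subseteq> T \<times> T" "X \<subseteq> T"
    by (auto simp: singletons_def dest!: equiv_type)
qed

lemma finite_PB_pairs:
  assumes "finite T"
  shows "finite {p. PB_pair T p}"
proof (rule finite_subset)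
  show "{p. PB_pair T p} \<subseteq> Pow (T \<times> T) \<times> Pow T"
  proof
    fix p assume "p \<in> {p. PB_pair T p}"
    then show "p \<in> Pow (T \<times> T) \<times> Pow T"
      using PB_pair_subset[of T "fst p" "snd p"] by (cases p) auto
  qed
  show "finite (Pow (T \<times> T) \<times> Pow T)" using assms by simp
qed

lemma nonsingleton_class:
  assumes "finite T" "one_two_equiv T \<epsilon>" "y \<in> T" "y \<notin> singletons T \<epsilon>"
  obtains z where "z \<in> T" "z \<noteq> y" "\<epsilon> `` {y} = {y, z}"
proof -
  have eq: "equiv T \<epsilon>" and c: "card (\<epsilon> `` {y}) \<le> 2"
    using assms one_two_equiv_iff by blast+
  have sub: "\<epsilon> `` {y} \<subseteq> T" using equiv_type[OF eq] by blast
  have y: "y \<in> \<epsilon> `` {y}" using eq assms(3) by (rule equiv_class_self)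
  then obtain z where z: "z \<in> \<epsilon> `` {y}" "z \<noteq> y"
    using assms(3,4) unfolding singletons_def by blast
  have "{y, z} = \<epsilon> `` {y}"
    using z y c finite_subset[OF sub assms(1)] by (intro card_seteq) auto
  then show thesis using that z sub by blast
qed

lemma equiv_restrict: "equiv T \<epsilon> \<Longrightarrow> U \<subseteq> T \<Longrightarrow> equiv U (\<epsilon> \<inter> U \<times> U)"
  unfolding equiv_def refl_on_def sym_def trans_def by blast

lemma one_two_equiv_restrict:
  assumes "finite T" "one_two_equiv T \<epsilon>" "U \<subseteq> T"
  shows "one_two_equiv U (\<epsilon> \<inter> U \<times> U)"
proof -
  have eq: "equiv T \<epsilon>" using assms(2) unfolding one_two_equiv_def by blast
  have "card ((\<epsilon> \<inter> U \<times> U) `` {x}) \<le> 2" if "x \<in> U" for x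
  proof -
    have "card ((\<epsilon> \<inter> U \<times> U) `` {x}) \<le> card (\<epsilon> `` {x})"
      using equiv_type[OF eq] assms(1) by (intro card_mono) (auto intro: finite_subset)
    also have "\<dots> \<le> 2" using assms that one_two_equiv_iff by blast
    finally show ?thesis .
  qed
  then show ?thesis
    using assms finite_subset equiv_restrict[OF eq] by (subst one_two_equiv_iff) auto
qed

section \<open>Adjoining a class\<close>

lemma equiv_Un_square_iff:
  assumes "T' \<inter> D = {}" "\<eta> \<subseteq> T' \<times> T'"
  shows "equiv (T' \<union> D) (\<eta> \<union> D \<times> D) \<longleftrightarrow> equiv T' \<eta>"
proof
  assume "equiv (T' \<union> D) (\<eta> \<union> D \<times> D)"
  then have "equiv T' ((\<eta> \<union> D \<times> D) \<inter> T' \<times> T')" by (rule equiv_restrict) simp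
  moreover have "(\<eta> \<union> D \<times> D) \<inter> T' \<times> T' = \<eta>" using assms by auto
  ultimately show "equiv T' \<eta>" by simp
next
  assume "equiv T' \<eta>"
  then show "equiv (T' \<union> D) (\<eta> \<union> D \<times> D)"
    using assms unfolding equiv_def refl_on_def sym_def trans_def by blast
qed

text \<open>
  The set \<open>Y\<close> records which points of the new class are put into the second component; a point
  may be put there only if it forms the whole class.
\<close>

lemma PB_pair_adjoin_iff:
  assumes fin: "finite T" and D: "D \<subseteq> T" "card D \<le> 2" and x: "x \<in> D"
    and sub: "\<eta> \<subseteq> (T - D) \<times> (T - D)" "X \<subseteq> T - D"
    and Y: "Y = {} \<or> D = {x} \<and> Y = {x}"
  shows "PB_pair T (\<eta> \<union> D \<times> D, X \<union> Y) \<longleftrightarrow> PB_pair (T - D) (\<eta>, X)"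
proof -
  have T: "(T - D) \<union> D = T" using D by blast
  have eq: "equiv T (\<eta> \<union> D \<times> D) \<longleftrightarrow> equiv (T - D) \<eta>"
    using equiv_Un_square_iff[of "T - D" D \<eta>] sub T by auto
  have im: "(\<eta> \<union> D \<times> D) `` {a} = \<eta> `` {a}" if "a \<in> T - D" for a
    using that by auto
  have im': "(\<eta> \<union> D \<times> D) `` {a} = D" if "a \<in> D" for a
    using that sub by auto
  have "(\<forall>a\<in>T. card ((\<eta> \<union> D \<times> D) `` {a}) \<le> 2) \<longleftrightarrow> (\<forall>a\<in>T - D. card (\<eta> `` {a}) \<le> 2)"
    using im im' D by (metis DiffD1 DiffI)
  then have "one_two_equiv T (\<eta> \<union> D \<times> D) \<longleftrightarrow> one_two_equiv (T - D) \<eta>"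
    using fin eq by (simp add: one_two_equiv_iff)
  moreover have "X \<union> Y \<subseteq> singletons T (\<eta> \<union> D \<times> D) \<longleftrightarrow> X \<subseteq> singletons (T - D) \<eta>"
  proof -
    have "a \<in> singletons T (\<eta> \<union> D \<times> D) \<longleftrightarrow> a \<in> singletons (T - D) \<eta>" if "a \<in> X" for a
      using that sub im[of a] unfolding singletons_def by auto
    moreover have "Y \<subseteq> singletons T (\<eta> \<union> D \<times> D)"
      using Y D x im'[of x] unfolding singletons_def by auto
    ultimately show ?thesis by blast
  qed
  ultimately show ?thesis by (simp add: PB_pair_iff)
qed

text \<open>
  Adjoining the class \<open>D\<close> is a bijection onto the PB-pairs that have \<open>D\<close> as the class of \<open>x\<close>. The
  predicates \<open>P\<close> and \<open>Q\<close> are kept abstract, because the lemma serves both for the rank condition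
  and for the plain enumeration of 1-2-equivalences.
\<close>

lemma card_PB_pairs_with_class:
  assumes fin: "finite T" and D: "D \<subseteq> T" "card D \<le> 2" and x: "x \<in> D"
    and Y: "Y = {} \<or> D = {x} \<and> Y = {x}"
    and PQ: "\<And>\<eta> X. PB_pair (T - D) (\<eta>, X) \<Longrightarrow> P (\<eta> \<union> D \<times> D) (X \<union> Y) \<longleftrightarrow> Q \<eta> X"
  shows "card {(\<eta>, X). PB_pair T (\<eta>, X) \<and> P \<eta> X \<and> \<eta> `` {x} = D \<and> X \<inter> D = Y} =
         card {(\<eta>, X). PB_pair (T - D) (\<eta>, X) \<and> Q \<eta> X}" (is "card ?L = card ?R")
proof -
  let ?f = "\<lambda>(\<eta>, X). (\<eta> \<union> D \<times> D, X \<union> Y)"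
  note sub = PB_pair_subset[of "T - D"]
  have YD: "Y \<subseteq> D" using Y x by auto
  have inj: "inj_on ?f ?R"
  proof (rule inj_onI, clarify)
    fix \<eta> X \<eta>' X'
    assume "PB_pair (T - D) (\<eta>, X)" "PB_pair (T - D) (\<eta>', X')"
      and eq: "\<eta> \<union> D \<times> D = \<eta>' \<union> D \<times> D" "X \<union> Y = X' \<union> Y"
    then have s: "\<eta> \<inter> D \<times> D = {}" "\<eta>' \<inter> D \<times> D = {}" "X \<inter> Y = {}" "X' \<inter> Y = {}"
      using sub YD by blast+
    show "\<eta> = \<eta>' \<and> X = X'" using eq s by blast
  qed
  have img: "?f ` ?R = ?L"
  proof (intro equalityI subsetI)
    fix p assume "p \<in> ?f ` ?R"
    then obtain \<eta> X where p: "p = (\<eta> \<union> D \<times> D, X \<union> Y)" and PB: "PB_pair (T - D) (\<eta>, X)" and "Q \<eta> X"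
      by auto
    have "PB_pair T (\<eta> \<union> D \<times> D, X \<union> Y)"
      using PB_pair_adjoin_iff[OF fin D x sub[OF PB] Y] PB by simp
    moreover have "(\<eta> \<union> D \<times> D) `` {x} = D" using x sub[OF PB] by auto
    moreover have "(X \<union> Y) \<inter> D = Y" using sub[OF PB] YD by auto
    ultimately show "p \<in> ?L" using p PQ[OF PB] \<open>Q \<eta> X\<close> by simp
  next
    fix p assume "p \<in> ?L"
    then obtain \<eta> X where p: "p = (\<eta>, X)" and PB: "PB_pair T (\<eta>, X)" and P: "P \<eta> X"
      and cl: "\<eta> `` {x} = D" and XD: "X \<inter> D = Y" by auto
    have eq: "equiv T \<eta>" and XT: "X \<subseteq> T"
      using PB unfolding PB_pair_iff one_two_equiv_def singletons_def by auto
    define \<eta>' where "\<eta>' = \<eta> \<inter> (T - D) \<times> (T - D)"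
    have cld: "(a, b) \<in> \<eta> \<Longrightarrow> a \<in> D \<longleftrightarrow> b \<in> D" for a b
      using eq cl unfolding equiv_def by (meson Image_singleton_iff symD transD)
    have DD: "D \<times> D \<subseteq> \<eta>"
      using eq cl unfolding equiv_def by (auto dest: symD transD)
    have \<eta>: "\<eta> = \<eta>' \<union> D \<times> D"
      using cld DD equiv_type[OF eq] unfolding \<eta>'_def by blast
    have X: "X = (X - D) \<union> Y" using XD by blast
    have "PB_pair (T - D) (\<eta>', X - D)"
      using PB_pair_adjoin_iff[OF fin D x, of \<eta>' "X - D" Y] PB \<eta> X XT Y unfolding \<eta>'_def by auto
    moreover from this have "Q \<eta>' (X - D)" using PQ P \<eta> X by metis
    ultimately have "(\<eta>', X - D) \<in> ?R" by simp
    moreover have "p = ?f (\<eta>', X - D)" using p \<eta> X by simp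
    ultimately show "p \<in> ?f ` ?R" by blast
  qed
  show ?thesis using card_image[OF inj] unfolding img .
qed

section \<open>Joins after deletion of a class\<close>

lemma equiv_join_mono:
  assumes "U \<subseteq> T" "\<epsilon> \<subseteq> T \<times> T" "\<eta> \<subseteq> T \<times> T" "\<epsilon>' \<subseteq> \<epsilon> \<inter> U \<times> U" "\<eta>' \<subseteq> \<eta> \<inter> U \<times> U"
  shows "equiv_join U \<epsilon>' \<eta>' \<subseteq> equiv_join T \<epsilon> \<eta>"
proof -
  have "equiv U (equiv_join T \<epsilon> \<eta> \<inter> U \<times> U)"
    by (intro equiv_restrict[OF equiv_equiv_join] assms)
  then have "equiv_join U \<epsilon>' \<eta>' \<subseteq> equiv_join T \<epsilon> \<eta> \<inter> U \<times> U"
    using assms(4,5) equiv_join_upper[of \<epsilon> T \<eta>] equiv_join_upper(2)[of \<eta> T \<epsilon>]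
    by (intro equiv_join_least) auto
  then show ?thesis by blast
qed

lemma equiv_join_separate:
  assumes D: "D \<subseteq> T" and \<eta>: "\<eta> \<subseteq> (T - D) \<times> (T - D)"
    and \<epsilon>: "\<epsilon> \<subseteq> (T - D) \<times> (T - D) \<union> D \<times> D"
  shows "equiv_join T \<epsilon> (\<eta> \<union> D \<times> D) = 
         equiv_join (T - D) (\<epsilon> \<inter> (T - D) \<times> (T - D)) \<eta> \<union> D \<times> D" (is "?\<theta> = ?\<theta>' \<union> _")
proof
  have e': "equiv (T - D) ?\<theta>'" using \<eta> by (intro equiv_equiv_join) auto
  have "equiv ((T - D) \<union> D) (?\<theta>' \<union> D \<times> D)"
    using e' equiv_type[OF e'] by (subst equiv_Un_square_iff) auto
  then have "equiv T (?\<theta>' \<union> D \<times> D)" using D by (simp add: Un_absorb1 Un_commute)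
  moreover have "\<epsilon> \<subseteq> ?\<theta>' \<union> D \<times> D" "\<eta> \<union> D \<times> D \<subseteq> ?\<theta>' \<union> D \<times> D"
    using \<epsilon> equiv_join_upper[of "\<epsilon> \<inter> (T - D) \<times> (T - D)" "T - D" \<eta>]
      equiv_join_upper(2)[of \<eta> "T - D" "\<epsilon> \<inter> (T - D) \<times> (T - D)"] by auto
  ultimately show "?\<theta> \<subseteq> ?\<theta>' \<union> D \<times> D" by (rule equiv_join_least)
  have "?\<theta>' \<subseteq> ?\<theta>" by (rule equiv_join_mono) (use D \<eta> \<epsilon> in auto)
  then show "?\<theta>' \<union> D \<times> D \<subseteq> ?\<theta>" using equiv_join_upper(2)[of "\<eta> \<union> D \<times> D" T \<epsilon>] by auto
qed

text \<open>
  The second equivalence does not link \<open>D\<close> to the outside at all. If \<open>\<epsilon>\<close> does so through a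
  single point \<open>z\<close> only, then no path between points
  outside \<open>D\<close> needs to enter \<open>D\<close>, since it could only return to \<open>z\<close>. So the join is the pullback
  of the smaller join along the map \<open>h\<close> that collapses \<open>D\<close> to \<open>z\<close>.
\<close>

lemma equiv_join_attached:
  assumes D: "D \<subseteq> T" and \<eta>: "\<eta> \<subseteq> (T - D) \<times> (T - D)"
    and \<epsilon>: "equiv T \<epsilon>" and y: "y \<in> D" "(y, z) \<in> \<epsilon>" and z: "z \<in> T - D"
    and only: "\<And>a b. (a, b) \<in> \<epsilon> \<Longrightarrow> a \<in> D \<Longrightarrow> b \<in> T - D \<Longrightarrow> b = z"
  defines "h \<equiv> \<lambda>a. if a \<in> D then z else a"
  shows "equiv_join T \<epsilon> (\<eta> \<union> D \<times> D) =
         {(a, b) \<in> T \<times> T. (h a, h b) \<in> equiv_join (T - D) (\<epsilon> \<inter> (T - D) \<times> (T - D)) \<eta>}"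
    (is "?\<theta> = ?\<psi>")
proof
  let ?\<theta>' = "equiv_join (T - D) (\<epsilon> \<inter> (T - D) \<times> (T - D)) \<eta>"
  have e': "equiv (T - D) ?\<theta>'" using \<eta> by (intro equiv_equiv_join) auto
  have hT: "h a \<in> T - D" if "a \<in> T" for a using that z unfolding h_def by auto
  have up: "\<epsilon> \<inter> (T - D) \<times> (T - D) \<subseteq> ?\<theta>'" "\<eta> \<subseteq> ?\<theta>'" by (rule equiv_join_upper)+
  have rf: "(a, a) \<in> ?\<theta>'" if "a \<in> T - D" for a
    using e' that unfolding equiv_def refl_on_def by blast
  have "equiv T ?\<psi>"
  proof (rule equivI)
    show "?\<psi> \<subseteq> T \<times> T" by blast
    show "refl_on T ?\<psi>" using rf hT unfolding refl_on_def by auto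
    show "sym ?\<psi>" using e' unfolding equiv_def sym_def by blast
    show "trans ?\<psi>" using e' unfolding equiv_def trans_def by blast
  qed
  moreover have "\<epsilon> \<subseteq> ?\<psi>"
  proof (rule subrelI)
    fix a b assume ab: "(a, b) \<in> \<epsilon>"
    then have T: "a \<in> T" "b \<in> T" using equiv_type[OF \<epsilon>] by auto
    have ba: "(b, a) \<in> \<epsilon>" using ab \<epsilon> unfolding equiv_def by (auto dest: symD)
    show "(a, b) \<in> ?\<psi>"
      using T ab only[OF ab] only[OF ba] up rf[OF z] unfolding h_def by auto
  qed
  moreover have "\<eta> \<union> D \<times> D \<subseteq> ?\<psi>"
    using \<eta> up D rf[OF z] unfolding h_def by auto
  ultimately show "?\<theta> \<subseteq> ?\<psi>" by (rule equiv_join_least)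
  have e: "equiv T ?\<theta>" using D \<eta> equiv_type[OF \<epsilon>] by (intro equiv_equiv_join) auto
  have le: "?\<theta>' \<subseteq> ?\<theta>" by (rule equiv_join_mono) (use D \<eta> equiv_type[OF \<epsilon>] in auto)
  have tr: "(a, b) \<in> ?\<theta> \<Longrightarrow> (b, c) \<in> ?\<theta> \<Longrightarrow> (a, c) \<in> ?\<theta>" 
    and sy: "(a, b) \<in> ?\<theta> \<Longrightarrow> (b, a) \<in> ?\<theta>" for a b c
    using e unfolding equiv_def by (auto dest: symD transD)
  have ha: "(a, h a) \<in> ?\<theta>" if "a \<in> T" for a
  proof (cases "a \<in> D")
    case True
    then have "(a, y) \<in> ?\<theta>" "(y, z) \<in> ?\<theta>"
      using y equiv_join_upper[of \<epsilon> T] equiv_join_upper(2)[of "\<eta> \<union> D \<times> D" T \<epsilon>] by auto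
    then show ?thesis using True tr unfolding h_def by simp
  next
    case False
    then show ?thesis using e that unfolding equiv_def refl_on_def h_def by auto
  qed
  show "?\<psi> \<subseteq> ?\<theta>"
  proof (rule subrelI)
    fix a b assume "(a, b) \<in> ?\<psi>"
    then have "a \<in> T" "b \<in> T" "(h a, h b) \<in> ?\<theta>" using le by auto
    then show "(a, b) \<in> ?\<theta>" using tr[OF ha tr[OF _ sy[OF ha]]] by blast
  qed
qed

section \<open>The recurrence for arbitrary marked 1-2-equivalences\<close>

text \<open>
  This is the set counted by \<open>\<mu>\<close>, with an arbitrary PB-pair \<open>(\<epsilon>, A)\<close> in place of the
  standard one; only this generality is closed under deleting classes.
\<close>

definition completions ::
  "'a set \<Rightarrow> ('a \<times> 'a) set \<Rightarrow> 'a set \<Rightarrow> nat \<Rightarrow> (('a \<times> 'a) set \<times> 'a set) set" where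
  "completions T \<epsilon> A q = {(\<eta>, X). PB_pair T (\<eta>, X) \<and> card X = q \<and>
     PB_rank (PB_join T (\<epsilon>, A) (\<eta>, X)) = q}"

lemma finite_completions: "finite T \<Longrightarrow> finite (completions T \<epsilon> A q)"
  by (rule finite_subset[OF _ finite_PB_pairs[of T]]) (auto simp: completions_def)

lemma PB_rank_PB_join:
  "PB_rank (PB_join T (\<epsilon>, A) (\<eta>, X)) = card (equiv_join T \<epsilon> \<eta> \<inter> A \<times> X)"
  unfolding PB_rank_def PB_join_def Let_def by (auto intro: arg_cong[where f = card])

lemma PB_pair_cases:
  assumes "PB_pair T (\<eta>, X)" "finite T" "x \<in> T"
  shows "\<eta> `` {x} = {x} \<and> x \<in> X \<or> \<eta> `` {x} = {x} \<and> x \<notin> X \<or>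
    (\<exists>y\<in>T - {x}. \<eta> `` {x} = {x, y} \<and> X \<inter> {x, y} = {})"
proof (cases "x \<in> singletons T \<eta>")
  case True
  then show ?thesis unfolding singletons_def by auto
next
  case False
  have o: "one_two_equiv T \<eta>" and X: "X \<subseteq> singletons T \<eta>" using assms(1) unfolding PB_pair_iff by blast+
  obtain y where y: "y \<in> T" "y \<noteq> x" "\<eta> `` {x} = {x, y}"
    using nonsingleton_class[OF assms(2) o assms(3) False] .
  have "sym \<eta>" using o unfolding one_two_equiv_def equiv_def by blast
  then have "x \<in> \<eta> `` {y}" using y(3) by (auto dest: symD)
  then have "y \<notin> X" using X y(2) unfolding singletons_def by auto
  then show ?thesis using y False X by auto
qed

lemma card_PB_pairs_split:
  assumes fin: "finite T" and x: "x \<in> T"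
  shows "card {(\<eta>, X). PB_pair T (\<eta>, X) \<and> P \<eta> X} =
      card {(\<eta>, X). PB_pair T (\<eta>, X) \<and> P \<eta> X \<and> \<eta> `` {x} = {x} \<and> X \<inter> {x} = {x}}
    + card {(\<eta>, X). PB_pair T (\<eta>, X) \<and> P \<eta> X \<and> \<eta> `` {x} = {x} \<and> X \<inter> {x} = {}}
    + (\<Sum>y\<in>T - {x}. card {(\<eta>, X). PB_pair T (\<eta>, X) \<and> P \<eta> X \<and> \<eta> `` {x} = {x, y} \<and> X \<inter> {x, y} = {}})"
    (is "card ?S = card ?A + card ?B + (\<Sum>y\<in>_. card (?C y))")
proof -
  have S: "?S = ?A \<union> ?B \<union> (\<Union>y\<in>T - {x}. ?C y)"
  proof (intro equalityI subsetI)
    fix p assume "p \<in> ?S"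
    then obtain \<eta> X where p: "p = (\<eta>, X)" "PB_pair T (\<eta>, X)" "P \<eta> X" by blast
    then show "p \<in> ?A \<union> ?B \<union> (\<Union>y\<in>T - {x}. ?C y)"
      using PB_pair_cases[OF p(2) fin x] by auto
  qed auto
  have f: "finite {(\<eta>, X). PB_pair T (\<eta>, X) \<and> R \<eta> X}" for R
    by (rule finite_subset[OF _ finite_PB_pairs[OF fin]]) auto
  have "card ?S = card (?A \<union> ?B) + card (\<Union>y\<in>T - {x}. ?C y)"
    unfolding S using fin f by (intro card_Un_disjoint) (auto intro!: f)
  also have "card (?A \<union> ?B) = card ?A + card ?B"
    using f by (intro card_Un_disjoint) (auto intro!: f)
  also have "card (\<Union>y\<in>T - {x}. ?C y) = (\<Sum>y\<in>T - {x}. card (?C y))"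
    using fin by (intro card_UN_disjoint) (auto intro!: f)
  finally show ?thesis .
qed

lemma PB_rank_adjoin_singleton:
  assumes \<epsilon>: "equiv T \<epsilon>" "\<epsilon> `` {x} = {x}" and x: "x \<in> T"
    and \<eta>: "\<eta> \<subseteq> (T - {x}) \<times> (T - {x})" and X: "X \<subseteq> T - {x}"
    and fin: "finite T" "A \<subseteq> T"
  defines "j \<equiv> PB_rank (PB_join (T - {x}) (\<epsilon> \<inter> (T - {x}) \<times> (T - {x}), A - {x}) (\<eta>, X))"
  shows "PB_rank (PB_join T (\<epsilon>, A) (\<eta> \<union> {x} \<times> {x}, X)) = j"
    and "x \<in> A \<Longrightarrow> PB_rank (PB_join T (\<epsilon>, A) (\<eta> \<union> {x} \<times> {x}, insert x X)) = Suc j"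
proof -
  let ?\<theta> = "equiv_join (T - {x}) (\<epsilon> \<inter> (T - {x}) \<times> (T - {x})) \<eta>"
  let ?Z = "?\<theta> \<inter> (A - {x}) \<times> X"
  have sym: "(a, b) \<in> \<epsilon> \<Longrightarrow> (b, a) \<in> \<epsilon>" for a b
    using \<epsilon>(1) unfolding equiv_def by (auto dest: symD)
  have "\<epsilon> \<subseteq> (T - {x}) \<times> (T - {x}) \<union> {x} \<times> {x}"
    using equiv_type[OF \<epsilon>(1)] \<epsilon>(2) sym by blast
  with x \<eta> have J: "equiv_join T \<epsilon> (\<eta> \<union> {x} \<times> {x}) = ?\<theta> \<union> {x} \<times> {x}"
    by (intro equiv_join_separate) auto
  have "equiv (T - {x}) ?\<theta>" using \<eta> by (intro equiv_equiv_join) auto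
  then have sq: "?\<theta> \<subseteq> (T - {x}) \<times> (T - {x})" by (rule equiv_type)
  have "equiv_join T \<epsilon> (\<eta> \<union> {x} \<times> {x}) \<inter> A \<times> X = ?Z"
    unfolding J using sq X by blast
  then show "PB_rank (PB_join T (\<epsilon>, A) (\<eta> \<union> {x} \<times> {x}, X)) = j"
    unfolding j_def PB_rank_PB_join by simp
  assume "x \<in> A"
  then have "equiv_join T \<epsilon> (\<eta> \<union> {x} \<times> {x}) \<inter> A \<times> insert x X = insert (x, x) ?Z"
    unfolding J using sq by blast
  moreover have "finite ?Z"
    using fin X by (meson finite_Diff finite_Int finite_SigmaI finite_subset)
  ultimately show "PB_rank (PB_join T (\<epsilon>, A) (\<eta> \<union> {x} \<times> {x}, insert x X)) = Suc j"
    unfolding j_def PB_rank_PB_join by simp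
qed

text \<open>
  The marks \<open>A \<union> \<epsilon> `` {y} - {x, y}\<close> treat two situations at once. If \<open>y\<close> is a singleton of
  \<open>\<epsilon>\<close>, no mark is created and the component \<open>{x, y}\<close> disappears. Otherwise the partner \<open>z\<close> of \<open>y\<close>
  is marked; it is a new mark because \<open>z\<close> is not a singleton of \<open>\<epsilon>\<close>, so it can take over exactly
  the joined pairs of \<open>x\<close>.
\<close>

lemma PB_rank_adjoin_edge:
  assumes fin: "finite T" and PB: "PB_pair T (\<epsilon>, A)" and x: "x \<in> A" and y: "y \<in> T - {x}"
    and \<eta>: "\<eta> \<subseteq> (T - {x, y}) \<times> (T - {x, y})" and X: "X \<subseteq> T - {x, y}"
  shows "PB_rank (PB_join T (\<epsilon>, A) (\<eta> \<union> {x, y} \<times> {x, y}, X)) =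
    PB_rank (PB_join (T - {x, y}) (\<epsilon> \<inter> (T - {x, y}) \<times> (T - {x, y}),
      (A \<union> \<epsilon> `` {y}) - {x, y}) (\<eta>, X))"
proof -
  have eq: "equiv T \<epsilon>" and otw: "one_two_equiv T \<epsilon>" and AS: "A \<subseteq> singletons T \<epsilon>"
    using PB unfolding PB_pair_iff one_two_equiv_def by blast+
  have A: "A \<subseteq> T" and Asing: "\<And>a. a \<in> A \<Longrightarrow> \<epsilon> `` {a} = {a}"
    using AS unfolding singletons_def by blast+
  have xT: "x \<in> T" using A x by blast
  have sym: "(a, b) \<in> \<epsilon> \<Longrightarrow> (b, a) \<in> \<epsilon>" for a b
    using eq unfolding equiv_def by (auto dest: symD)
  have \<epsilon>T: "\<epsilon> \<subseteq> T \<times> T" using eq by (rule equiv_type)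
  have onlyx: "(a, x) \<in> \<epsilon> \<Longrightarrow> a = x" "(x, a) \<in> \<epsilon> \<Longrightarrow> a = x" for a
    using Asing[OF x] sym by blast+
  let ?D = "{x, y}"
  let ?\<theta>' = "equiv_join (T - ?D) (\<epsilon> \<inter> (T - ?D) \<times> (T - ?D)) \<eta>"
  have "equiv (T - ?D) ?\<theta>'" using \<eta> by (intro equiv_equiv_join) auto
  then have sq: "?\<theta>' \<subseteq> (T - ?D) \<times> (T - ?D)" by (rule equiv_type)
  have "card (equiv_join T \<epsilon> (\<eta> \<union> ?D \<times> ?D) \<inter> A \<times> X) = card (?\<theta>' \<inter> ((A \<union> \<epsilon> `` {y}) - ?D) \<times> X)"
  proof (cases "y \<in> singletons T \<epsilon>")
    case True
    then have cy: "\<epsilon> `` {y} = {y}" unfolding singletons_def by simp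
    have onlyy: "(a, y) \<in> \<epsilon> \<Longrightarrow> a = y" "(y, a) \<in> \<epsilon> \<Longrightarrow> a = y" for a
      using cy sym by blast+
    have "\<epsilon> \<subseteq> (T - ?D) \<times> (T - ?D) \<union> ?D \<times> ?D"
    proof (rule subrelI)
      fix a b assume "(a, b) \<in> \<epsilon>"
      then show "(a, b) \<in> (T - ?D) \<times> (T - ?D) \<union> ?D \<times> ?D"
        using \<epsilon>T onlyx onlyy by fast
    qed
    with xT y \<eta> have J: "equiv_join T \<epsilon> (\<eta> \<union> ?D \<times> ?D) = ?\<theta>' \<union> ?D \<times> ?D"
      by (intro equiv_join_separate) auto
    have "equiv_join T \<epsilon> (\<eta> \<union> ?D \<times> ?D) \<inter> A \<times> X = ?\<theta>' \<inter> ((A \<union> \<epsilon> `` {y}) - ?D) \<times> X"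
      unfolding J cy using sq X by blast
    then show ?thesis by simp
  next
    case False
    have yT: "y \<in> T" using y by simp
    obtain z where z: "z \<in> T" "z \<noteq> y" "\<epsilon> `` {y} = {y, z}"
      using nonsingleton_class[OF fin otw yT False] .
    have yz: "(y, z) \<in> \<epsilon>" using z by blast
    have zx: "z \<noteq> x" using yz onlyx y by blast
    have yA: "y \<notin> A" using Asing[of y] z by auto
    have zA: "z \<notin> A" using Asing[of z] sym[OF yz] z by auto
    define h where "h = (\<lambda>a. if a \<in> ?D then z else a)"
    have only: "b = z" if "(a, b) \<in> \<epsilon>" "a \<in> ?D" "b \<in> T - ?D" for a b
      using that z(3) onlyx by blast
    have J: "equiv_join T \<epsilon> (\<eta> \<union> ?D \<times> ?D) = {(a, b) \<in> T \<times> T. (h a, h b) \<in> ?\<theta>'}"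
      unfolding h_def
      by (rule equiv_join_attached[where y = y, OF _ \<eta> eq _ yz _ only]) (use xT yT z zx in auto)
    have hb: "h b = b" if "b \<in> X" for b using that X unfolding h_def by auto
    have AD: "(A \<union> \<epsilon> `` {y}) - ?D = insert z (A - {x})"
      using z zx yA by auto
    have hA: "h x = z" "\<And>a. a \<in> A - {x} \<Longrightarrow> h a = a" using yA unfolding h_def by auto
    \<comment> \<open>On \<open>A\<close> the collapsing map only renames \<open>x\<close> to \<open>z\<close>, so it transports the joined pairs.\<close>
    have "bij_betw (map_prod h id) (equiv_join T \<epsilon> (\<eta> \<union> ?D \<times> ?D) \<inter> A \<times> X)
      (?\<theta>' \<inter> insert z (A - {x}) \<times> X)"
    proof (rule bij_betw_imageI)
      have "inj_on h A"
        using hA zA by (intro inj_onI) (metis insert_Diff insert_iff x)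
      then have "inj_on (map_prod h id) (A \<times> X)" by (intro map_prod_inj_on) auto
      then show "inj_on (map_prod h id) (equiv_join T \<epsilon> (\<eta> \<union> ?D \<times> ?D) \<inter> A \<times> X)"
        by (rule inj_on_subset) simp
      show "map_prod h id ` (equiv_join T \<epsilon> (\<eta> \<union> ?D \<times> ?D) \<inter> A \<times> X) =
        ?\<theta>' \<inter> insert z (A - {x}) \<times> X"
      proof (intro equalityI subsetI)
        fix p assume "p \<in> map_prod h id ` (equiv_join T \<epsilon> (\<eta> \<union> ?D \<times> ?D) \<inter> A \<times> X)"
        then obtain a b where p: "p = (h a, b)" "a \<in> A" "b \<in> X" "(h a, h b) \<in> ?\<theta>'"
          unfolding J by auto
        have "h a \<in> insert z (A - {x})" using hA p(2) by (cases "a = x") auto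
        then show "p \<in> ?\<theta>' \<inter> insert z (A - {x}) \<times> X" using p hb by simp
      next
        fix p assume "p \<in> ?\<theta>' \<inter> insert z (A - {x}) \<times> X"
        then obtain c b where p: "p = (c, b)" "c \<in> insert z (A - {x})" "b \<in> X" "(c, b) \<in> ?\<theta>'"
          by blast
        obtain a where a: "a \<in> A" "h a = c" using p(2) hA x by auto
        then have "(a, b) \<in> equiv_join T \<epsilon> (\<eta> \<union> ?D \<times> ?D) \<inter> A \<times> X"
          unfolding J using p A hb X by auto
        moreover have "p = map_prod h id (a, b)" using p a by simp
        ultimately show "p \<in> map_prod h id ` (equiv_join T \<epsilon> (\<eta> \<union> ?D \<times> ?D) \<inter> A \<times> X)"
          by blast
      qed
    qed
    then show ?thesis unfolding AD by (rule bij_betw_same_card)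
  qed
  then show ?thesis unfolding PB_rank_PB_join .
qed

lemma completions_split:
  assumes fin: "finite T" and PB: "PB_pair T (\<epsilon>, A)" and x: "x \<in> A" and q: "q > 0"
  defines "\<epsilon>' \<equiv> \<lambda>D. \<epsilon> \<inter> (T - D) \<times> (T - D)"
  shows "card (completions T \<epsilon> A q) =
      card (completions (T - {x}) (\<epsilon>' {x}) (A - {x}) (q - 1))
    + card (completions (T - {x}) (\<epsilon>' {x}) (A - {x}) q)
    + (\<Sum>y\<in>T - {x}. card (completions (T - {x, y}) (\<epsilon>' {x, y})
          ((A \<union> \<epsilon> `` {y}) - {x, y}) q))"
proof -
  have eq: "equiv T \<epsilon>" using PB unfolding PB_pair_iff one_two_equiv_def by blast
  have AT: "A \<subseteq> T" by (rule PB_pair_subset[OF PB])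
  have "A \<subseteq> singletons T \<epsilon>" using PB unfolding PB_pair_iff by blast
  then have xT: "x \<in> T" and cx: "\<epsilon> `` {x} = {x}" using x unfolding singletons_def by blast+
  let ?P = "\<lambda>\<eta> X. card X = q \<and> PB_rank (PB_join T (\<epsilon>, A) (\<eta>, X)) = q"
  let ?Q = "\<lambda>U \<epsilon> A q \<eta> X. card X = q \<and> PB_rank (PB_join U (\<epsilon>, A) (\<eta>, X)) = q"
  have 1: "card {(\<eta>, X). PB_pair T (\<eta>, X) \<and> ?P \<eta> X \<and> \<eta> `` {x} = {x} \<and> X \<inter> {x} = {x}} =
     card {(\<eta>, X). PB_pair (T - {x}) (\<eta>, X) \<and> ?Q (T - {x}) (\<epsilon>' {x}) (A - {x}) (q - 1) \<eta> X}"
  proof (rule card_PB_pairs_with_class[OF fin])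
    fix \<eta> X assume PB': "PB_pair (T - {x}) (\<eta>, X)"
    note sub = PB_pair_subset[OF PB']
    have "card (insert x X) = Suc (card X)"
      using sub(2) fin by (meson Diff_iff card_insert_disjoint finite_Diff finite_subset insertI1 subsetD)
    then show "?P (\<eta> \<union> {x} \<times> {x}) (X \<union> {x}) \<longleftrightarrow> ?Q (T - {x}) (\<epsilon>' {x}) (A - {x}) (q - 1) \<eta> X"
      using PB_rank_adjoin_singleton(2)[OF eq cx xT sub fin AT x] q unfolding \<epsilon>'_def by auto
  qed (use xT in auto)
  have 2: "card {(\<eta>, X). PB_pair T (\<eta>, X) \<and> ?P \<eta> X \<and> \<eta> `` {x} = {x} \<and> X \<inter> {x} = {}} =
     card {(\<eta>, X). PB_pair (T - {x}) (\<eta>, X) \<and> ?Q (T - {x}) (\<epsilon>' {x}) (A - {x}) q \<eta> X}"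
  proof (rule card_PB_pairs_with_class[OF fin])
    fix \<eta> X assume PB': "PB_pair (T - {x}) (\<eta>, X)"
    note sub = PB_pair_subset[OF PB']
    show "?P (\<eta> \<union> {x} \<times> {x}) (X \<union> {}) \<longleftrightarrow> ?Q (T - {x}) (\<epsilon>' {x}) (A - {x}) q \<eta> X"
      using PB_rank_adjoin_singleton(1)[OF eq cx xT sub fin AT] unfolding \<epsilon>'_def by auto
  qed (use xT in auto)
  have 3: "card {(\<eta>, X). PB_pair T (\<eta>, X) \<and> ?P \<eta> X \<and> \<eta> `` {x} = {x, y} \<and> X \<inter> {x, y} = {}} =
     card {(\<eta>, X). PB_pair (T - {x, y}) (\<eta>, X) \<and> 
       ?Q (T - {x, y}) (\<epsilon>' {x, y}) ((A \<union> \<epsilon> `` {y}) - {x, y}) q \<eta> X}" if y: "y \<in> T - {x}" for y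
  proof (rule card_PB_pairs_with_class[OF fin])
    fix \<eta> X assume PB': "PB_pair (T - {x, y}) (\<eta>, X)"
    show "?P (\<eta> \<union> {x, y} \<times> {x, y}) (X \<union> {}) \<longleftrightarrow> 
       ?Q (T - {x, y}) (\<epsilon>' {x, y}) ((A \<union> \<epsilon> `` {y}) - {x, y}) q \<eta> X"
      using PB_rank_adjoin_edge[OF fin PB x y PB_pair_subset[OF PB']] unfolding \<epsilon>'_def by simp
  qed (use xT y in \<open>auto simp: card_insert_if\<close>)
  have "card (completions T \<epsilon> A q) =
      card {(\<eta>, X). PB_pair T (\<eta>, X) \<and> ?P \<eta> X \<and> \<eta> `` {x} = {x} \<and> X \<inter> {x} = {x}}
    + card {(\<eta>, X). PB_pair T (\<eta>, X) \<and> ?P \<eta> X \<and> \<eta> `` {x} = {x} \<and> X \<inter> {x} = {}}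
    + (\<Sum>y\<in>T - {x}. card {(\<eta>, X). PB_pair T (\<eta>, X) \<and> ?P \<eta> X \<and> \<eta> `` {x} = {x, y} \<and> X \<inter> {x, y} = {}})"
    unfolding completions_def by (rule card_PB_pairs_split[OF fin xT])
  also have "\<dots> = card (completions (T - {x}) (\<epsilon>' {x}) (A - {x}) (q - 1))
    + card (completions (T - {x}) (\<epsilon>' {x}) (A - {x}) q)
    + (\<Sum>y\<in>T - {x}. card (completions (T - {x, y}) (\<epsilon>' {x, y})
          ((A \<union> \<epsilon> `` {y}) - {x, y}) q))"
    unfolding completions_def by (intro arg_cong2[where f = "(+)"] 1 2 sum.cong refl 3)
  finally show ?thesis .
qed

lemma PB_pair_delete_singletons:
  assumes fin: "finite T" and PB: "PB_pair T (\<epsilon>, A)" and D: "D \<subseteq> singletons T \<epsilon>"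
  shows "PB_pair (T - D) (\<epsilon> \<inter> (T - D) \<times> (T - D), A - D)"
    and "singletons (T - D) (\<epsilon> \<inter> (T - D) \<times> (T - D)) = singletons T \<epsilon> - D"
proof -
  have otw: "one_two_equiv T \<epsilon>" and eq: "equiv T \<epsilon>" and A: "A \<subseteq> singletons T \<epsilon>"
    using PB unfolding PB_pair_iff one_two_equiv_def by blast+
  have "(\<epsilon> \<inter> (T - D) \<times> (T - D)) `` {a} = \<epsilon> `` {a}" if "a \<in> T - D" for a
  proof -
    have "b \<notin> D" if "(a, b) \<in> \<epsilon>" for b
    proof
      assume "b \<in> D"
      moreover have "(b, a) \<in> \<epsilon>" using eq that unfolding equiv_def by (auto dest: symD)
      moreover have "\<epsilon> `` {b} = {b}" using D \<open>b \<in> D\<close> unfolding singletons_def by blast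
      ultimately show False using \<open>a \<in> T - D\<close> by auto
    qed
    then show ?thesis using that equiv_type[OF eq] by blast
  qed
  then show S: "singletons (T - D) (\<epsilon> \<inter> (T - D) \<times> (T - D)) = singletons T \<epsilon> - D"
    unfolding singletons_def by auto
  show "PB_pair (T - D) (\<epsilon> \<inter> (T - D) \<times> (T - D), A - D)"
    unfolding PB_pair_iff S using A one_two_equiv_restrict[OF fin otw] by blast
qed

text \<open>
  Contraction trades the singleton \<open>x\<close> of \<open>\<epsilon>\<close> for the new singleton \<open>z\<close>, and the mark of \<open>x\<close> for
  a mark of \<open>z\<close>. This is why only the number of points drops.
\<close>

lemma PB_pair_contract_edge:
  assumes fin: "finite T" and PB: "PB_pair T (\<epsilon>, A)" and x: "x \<in> A"
    and y: "y \<in> T - singletons T \<epsilon>"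
  defines "U \<equiv> T - {x, y}" and "A' \<equiv> (A \<union> \<epsilon> `` {y}) - {x, y}"
  shows "PB_pair U (\<epsilon> \<inter> U \<times> U, A')"
    and "card (singletons U (\<epsilon> \<inter> U \<times> U)) = card (singletons T \<epsilon>)"
    and "card A' = card A"
proof -
  have otw: "one_two_equiv T \<epsilon>" and eq: "equiv T \<epsilon>" and A: "A \<subseteq> singletons T \<epsilon>"
    using PB unfolding PB_pair_iff one_two_equiv_def by blast+
  obtain z where z: "z \<in> T" "z \<noteq> y" "\<epsilon> `` {y} = {y, z}"
    using nonsingleton_class[OF fin otw] y by blast
  have sym: "(a, b) \<in> \<epsilon> \<Longrightarrow> (b, a) \<in> \<epsilon>" for a b
    using eq unfolding equiv_def by (auto dest: symD)
  have xS: "x \<in> singletons T \<epsilon>" using A x by blast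
  have yz: "(y, z) \<in> \<epsilon>" using z by blast
  have cz: "\<epsilon> `` {z} = {y, z}" using equiv_class_eq[OF eq yz] z(3) by simp
  have zS: "z \<notin> singletons T \<epsilon>" using cz z(2) unfolding singletons_def by auto
  have zx: "z \<noteq> x" using zS xS by blast
  have yA: "y \<notin> A" "z \<notin> A" using A y zS by blast+
  have A': "A' = insert z (A - {x})" unfolding A'_def using z zx yA by auto
  have fA: "finite A" using PB_pair_subset(2)[OF PB] fin finite_subset by blast
  show "card A' = card A" unfolding A' using fA x yA by (simp add: card_Suc_Diff1 card_insert_if del: card_Diff_insert card_Diff_singleton)
  have im: "(\<epsilon> \<inter> U \<times> U) `` {a} = \<epsilon> `` {a}" if "a \<in> U" "a \<noteq> z" for a
  proof -
    have "b \<noteq> x \<and> b \<noteq> y" if "(a, b) \<in> \<epsilon>" for b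
      using sym[OF that] xS z(3) \<open>a \<in> U\<close> \<open>a \<noteq> z\<close> unfolding singletons_def U_def by blast
    then show ?thesis using that equiv_type[OF eq] unfolding U_def by blast
  qed
  have imz: "(\<epsilon> \<inter> U \<times> U) `` {z} = {z}" using cz z(1,2) zx unfolding U_def by blast
  have S: "singletons U (\<epsilon> \<inter> U \<times> U) = insert z (singletons T \<epsilon> - {x})"
  proof (intro set_eqI)
    fix a
    show "a \<in> singletons U (\<epsilon> \<inter> U \<times> U) \<longleftrightarrow> a \<in> insert z (singletons T \<epsilon> - {x})"
    proof (cases "a = z")
      case True
      then show ?thesis using imz z zx unfolding singletons_def U_def by simp
    next
      case False
      then show ?thesis using im[of a] y unfolding singletons_def U_def by auto
    qed
  qed
  have "finite (singletons T \<epsilon>)" using fin unfolding singletons_def by simp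
  then show "card (singletons U (\<epsilon> \<inter> U \<times> U)) = card (singletons T \<epsilon>)"
    unfolding S using xS zS by (simp add: card_Suc_Diff1 card_insert_if del: card_Diff_insert card_Diff_singleton)
  show "PB_pair U (\<epsilon> \<inter> U \<times> U, A')"
    unfolding PB_pair_iff S A' using A one_two_equiv_restrict[OF fin otw, of U] unfolding U_def by blast
qed

text \<open>
  The function \<open>g\<close> stands for the numbers in the recurrence. It is only assumed to count
  completions on smaller sets, so that this lemma can serve as the step of an induction proving
  that \<open>\<mu>\<close> has this property on all sets. The parity condition is what makes the
  standard structure with the same parameters available there.
\<close>

lemma completions_recurrence:
  fixes g :: "nat \<Rightarrow> nat \<Rightarrow> nat \<Rightarrow> nat \<Rightarrow> nat" and T :: "'a set"
  assumes fin: "finite T" and PB: "PB_pair T (\<epsilon>, A)" and A: "A \<noteq> {}" and q: "q > 0"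
    and par: "[card (singletons T \<epsilon>) = card T] (mod 2)"
    and g: "\<And>(T' :: 'a set) \<epsilon>' A' q'. finite T' \<Longrightarrow> card T' < card T \<Longrightarrow> PB_pair T' (\<epsilon>', A') \<Longrightarrow>
      [card (singletons T' \<epsilon>') = card T'] (mod 2) \<Longrightarrow>
      card (completions T' \<epsilon>' A' q') = g (card T') (card (singletons T' \<epsilon>')) (card A') q'"
  defines "n \<equiv> card T" and "k \<equiv> card (singletons T \<epsilon>)" and "r \<equiv> card A"
  shows "card (completions T \<epsilon> A q) =
      (n - k) * g (n - 2) k r q + g (n - 1) (k - 1) (r - 1) (q - 1) + g (n - 1) (k - 1) (r - 1) q
    + (k - r) * g (n - 2) (k - 2) (r - 1) q + (r - 1) * g (n - 2) (k - 2) (r - 2) q"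
proof -
  obtain x where x: "x \<in> A" using A by blast
  let ?S = "singletons T \<epsilon>"
  let ?res = "\<lambda>D. \<epsilon> \<inter> (T - D) \<times> (T - D)"
  let ?c = "\<lambda>y. card (completions (T - {x, y}) (?res {x, y}) ((A \<union> \<epsilon> `` {y}) - {x, y}) q)"
  have AS: "A \<subseteq> ?S" using PB unfolding PB_pair_iff by blast
  have ST: "?S \<subseteq> T" unfolding singletons_def by blast
  have fS: "finite ?S" using ST fin by (rule finite_subset)
  have fA: "finite A" using AS fS by (rule finite_subset)
  have xS: "x \<in> ?S" and xT: "x \<in> T" using x AS ST by blast+
  have one: "card (completions (T - {x}) (?res {x}) (A - {x}) q') = g (n - 1) (k - 1) (r - 1) q'" for q'
  proof -
    note del = PB_pair_delete_singletons[OF fin PB, of "{x}"]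
    have "card T > 0" "card ?S > 0" using fin fS xS xT by (auto simp: card_gt_0_iff)
    then have "[card ?S - 1 = card T - 1] (mod 2)"
      using par by (intro cong_diff_nat) auto
    moreover have "card (T - {x}) < card T" using fin xT by (rule card_Diff1_less)
    ultimately show ?thesis
      using g[of "T - {x}" "?res {x}" "A - {x}" q'] del fin fS fA xS xT x
      unfolding n_def k_def r_def by simp
  qed
  have two: "?c y = g (n - 2) (k - 2) (card (A - {x, y})) q" if y: "y \<in> ?S - {x}" for y
  proof -
    have D: "{x, y} \<subseteq> ?S" using xS y by blast
    note del = PB_pair_delete_singletons[OF fin PB D]
    have cy: "(A \<union> \<epsilon> `` {y}) - {x, y} = A - {x, y}" using y unfolding singletons_def by auto
    have c: "card (T - {x, y}) = card T - 2" "card (?S - {x, y}) = card ?S - 2"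
      using D y ST by (subst card_Diff_subset; auto)+
    have "card {x, y} \<le> card ?S" "card {x, y} \<le> card T"
      using D ST fS fin by (auto intro!: card_mono)
    then have le: "card ?S \<ge> 2" "card T \<ge> 2" using y by auto
    then have "[card ?S - 2 = card T - 2] (mod 2)"
      using par by (intro cong_diff_nat) auto
    then show ?thesis
      using g[of "T - {x, y}" "?res {x, y}" "A - {x, y}" q] del fin le c
      unfolding n_def k_def cy by simp
  qed
  have three: "?c y = g (n - 2) k r q" if y: "y \<in> T - ?S" for y
  proof -
    note con = PB_pair_contract_edge[OF fin PB x y]
    have yx: "y \<noteq> x" using y xS by blast
    have c: "card (T - {x, y}) = card T - 2"
      using yx xT y by (subst card_Diff_subset) auto
    have "card {x, y} \<le> card T"
      using xT y fin by (intro card_mono) auto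
    then have le: "card T \<ge> 2" using yx by auto
    then have "[card ?S = card T - 2] (mod 2)"
      using par le_mod_geq[of 2 "card T"] unfolding cong_def by simp
    then show ?thesis
      using g[of "T - {x, y}" "?res {x, y}" "(A \<union> \<epsilon> `` {y}) - {x, y}" q] con fin le c
      unfolding n_def k_def r_def by simp
  qed
  have "T - {x} = (T - ?S) \<union> (?S - A) \<union> (A - {x})"
    using AS ST xS x by blast
  then have "(\<Sum>y\<in>T - {x}. ?c y) = (\<Sum>y\<in>(T - ?S) \<union> (?S - A) \<union> (A - {x}). ?c y)"
    by simp
  also have "\<dots> = (\<Sum>y\<in>T - ?S. ?c y) + (\<Sum>y\<in>?S - A. ?c y) + (\<Sum>y\<in>A - {x}. ?c y)"
    using fin fS fA AS by (subst sum.union_disjoint; (subst sum.union_disjoint)?) auto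
  also have "(\<Sum>y\<in>T - ?S. ?c y) = (n - k) * g (n - 2) k r q"
    using three fS ST by (simp add: n_def k_def card_Diff_subset)
  also have "(\<Sum>y\<in>?S - A. ?c y) = (k - r) * g (n - 2) (k - 2) (r - 1) q"
  proof -
    have "?c y = g (n - 2) (k - 2) (r - 1) q" if y: "y \<in> ?S - A" for y
    proof -
      have "A - {x, y} = A - {x}" using y by blast
      then have "card (A - {x, y}) = r - 1" using x fA unfolding r_def by simp
      moreover have "y \<in> ?S - {x}" using y x by blast
      ultimately show ?thesis using two[of y] by simp
    qed
    then show ?thesis using fA AS by (simp add: k_def r_def card_Diff_subset)
  qed
  also have "(\<Sum>y\<in>A - {x}. ?c y) = (r - 1) * g (n - 2) (k - 2) (r - 2) q"
  proof -
    have "?c y = g (n - 2) (k - 2) (r - 2) q" if y: "y \<in> A - {x}" for y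
    proof -
      have "card (A - {x, y}) = r - 2" using x y unfolding r_def by (subst card_Diff_subset) auto
      moreover have "y \<in> ?S - {x}" using y AS by blast
      ultimately show ?thesis using two[of y] by simp
    qed
    then show ?thesis using fA x by (simp add: r_def)
  qed
  finally show ?thesis
    using completions_split[OF fin PB x q] one by simp
qed

section \<open>Large rank and rank zero\<close>

text \<open>
  Each deletion removes at least as many marks as it removes points of \<open>X\<close>, so the inequality
  survives until no marks are left, and then the rank is \<open>0\<close>.
\<close>

lemma completions_empty:
  assumes "finite T" "PB_pair T (\<epsilon>, A)" "card A < q"
  shows "completions T \<epsilon> A q = {}"
  using assms
proof (induction "card T" arbitrary: T \<epsilon> A q rule: less_induct)
  case less
  show ?case
  proof (cases "A = {}")
    case True
    then show ?thesis using less.prems(3) unfolding completions_def PB_rank_PB_join by auto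
  next
    case False
    then obtain x where x: "x \<in> A" by blast
    note fin = less.prems(1) and PB = less.prems(2)
    have q: "q > 0" using less.prems(3) by simp
    have AS: "A \<subseteq> singletons T \<epsilon>" using PB unfolding PB_pair_iff by blast
    have xT: "x \<in> T" and fA: "finite A"
      using x AS fin unfolding singletons_def by (blast, auto intro: finite_subset)
    have smaller: "card (T - D) < card T" if "x \<in> D" for D
      using that xT fin by (intro psubset_card_mono) auto
    have one: "completions (T - {x}) (\<epsilon> \<inter> (T - {x}) \<times> (T - {x})) (A - {x}) q' = {}" if "q' \<ge> q - 1" for q'
    proof (rule less.hyps)
      have "card A > 0" using x fA by (auto simp: card_gt_0_iff)
      then show "card (A - {x}) < q'" using x fA less.prems(3) that by simp
    qed (use smaller fin AS x PB_pair_delete_singletons[OF fin PB, of "{x}"] in auto)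
    have two: "completions (T - {x, y}) (\<epsilon> \<inter> (T - {x, y}) \<times> (T - {x, y}))
        ((A \<union> \<epsilon> `` {y}) - {x, y}) q = {}" if y: "y \<in> T - {x}" for y
    proof (cases "y \<in> singletons T \<epsilon>")
      case True
      then have cy: "(A \<union> \<epsilon> `` {y}) - {x, y} = A - {x, y}" unfolding singletons_def by auto
      have "card (A - {x, y}) \<le> card A" using fA by (intro card_mono) auto
      then show ?thesis
        unfolding cy using True AS x smaller[of "{x, y}"] less.prems(3) fin
        by (intro less.hyps PB_pair_delete_singletons[OF fin PB]) auto
    next
      case False
      then have "y \<in> T - singletons T \<epsilon>" using y by blast
      note con = PB_pair_contract_edge[OF fin PB x this]
      show ?thesis using con smaller[of "{x, y}"] less.prems(3) fin by (intro less.hyps) auto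
    qed
    have "card (completions T \<epsilon> A q) = 0"
      unfolding completions_split[OF fin PB x q] using one two by simp
    then show ?thesis using finite_completions[OF fin] by simp
  qed
qed

definition matchings :: "nat \<Rightarrow> nat" where
  "matchings n = (\<Sum>i = 0..n div 2. (n choose (2 * i)) * double_fact (2 * int i - 1))"

text \<open>
  An upper limit of the sum that does not depend on \<open>n\<close> allows termwise comparison for different
  \<open>n\<close>; the additional terms vanish.
\<close>

lemma matchings_eq:
  assumes "n div 2 \<le> N"
  shows "matchings n = (\<Sum>i\<le>N. (n choose (2 * i)) * double_fact (2 * int i - 1))"
  unfolding matchings_def using assms
  by (intro sum.mono_neutral_left) (auto simp: binomial_eq_0)

text \<open>
  Pascal's rule splits each term. The second part is turned into a multiple of the preceding term
  for \<open>n\<close> by absorbing the leading factor \<open>2i + 1\<close> of the double factorial into the binomial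
  coefficient.
\<close>

lemma matchings_Suc_Suc: "matchings (Suc (Suc n)) = matchings (Suc n) + Suc n * matchings n"
proof -
  let ?d = "\<lambda>i::nat. double_fact (2 * int i - 1)"
  have "Suc (Suc n) choose (2 * Suc i) = (Suc n choose (2 * Suc i)) + (Suc n choose Suc (2 * i))" for i
    by simp
  moreover have "(Suc n choose Suc (2 * i)) * ?d (Suc i) = Suc n * ((n choose (2 * i)) * ?d i)" for i
  proof -
    have d: "?d (Suc i) = Suc (2 * i) * ?d i"
      by (subst double_fact.simps) (simp add: nat_add_distrib nat_mult_distrib algebra_simps)
    have "(Suc n choose Suc (2 * i)) * ?d (Suc i) = (Suc (2 * i) * (Suc n choose Suc (2 * i))) * ?d i"
      unfolding d by (simp only: mult_ac)
    also have "Suc (2 * i) * (Suc n choose Suc (2 * i)) = Suc n * (n choose (2 * i))"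
      using Suc_times_binomial_eq[of n "2 * i"] by (simp only: mult.commute)
    finally show ?thesis by (simp only: mult_ac)
  qed
  ultimately have step: "(Suc (Suc n) choose (2 * Suc i)) * ?d (Suc i) =
      (Suc n choose (2 * Suc i)) * ?d (Suc i) + Suc n * ((n choose (2 * i)) * ?d i)" for i
    by (simp only: add_mult_distrib)
  have "matchings (Suc (Suc n)) = (\<Sum>i\<le>Suc n. (Suc (Suc n) choose (2 * i)) * ?d i)"
    by (rule matchings_eq) simp
  also have "\<dots> = ?d 0 + (\<Sum>i\<le>n. (Suc (Suc n) choose (2 * Suc i)) * ?d (Suc i))"
    by (subst sum.atMost_Suc_shift) simp
  also have "\<dots> = (?d 0 + (\<Sum>i\<le>n. (Suc n choose (2 * Suc i)) * ?d (Suc i)))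
      + Suc n * (\<Sum>i\<le>n. (n choose (2 * i)) * ?d i)"
    unfolding step sum.distrib sum_distrib_left by simp
  also have "?d 0 + (\<Sum>i\<le>n. (Suc n choose (2 * Suc i)) * ?d (Suc i)) =
      (\<Sum>i\<le>Suc n. (Suc n choose (2 * i)) * ?d i)"
    by (subst sum.atMost_Suc_shift) simp
  also have "\<dots> = matchings (Suc n)" by (rule matchings_eq[symmetric]) simp
  also have "(\<Sum>i\<le>n. (n choose (2 * i)) * ?d i) = matchings n" by (rule matchings_eq[symmetric]) simp
  finally show ?thesis .
qed

lemma matchings_0_1: "matchings 0 = 1" "matchings (Suc 0) = 1"
  by (simp_all add: matchings_def double_fact.simps)

text \<open>
  The class of a chosen point is either that point alone or one of \<open>card T - 1\<close> pairs.
\<close>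

lemma card_unmarked_PB_pairs:
  assumes "finite T"
  shows "card {(\<eta>, X). PB_pair T (\<eta>, X) \<and> X = {}} = matchings (card T)"
  using assms
proof (induction "card T" arbitrary: T rule: less_induct)
  case less
  note fin = less.prems
  show ?case
  proof (cases "T = {}")
    case True
    have "PB_pair {} (\<eta>, {}) \<longleftrightarrow> \<eta> = {}" for \<eta> :: "('a \<times> 'a) set"
      by (auto simp: PB_pair_iff one_two_equiv_def equiv_def refl_on_def sym_def trans_def)
    then have "{(\<eta>, X). PB_pair T (\<eta>, X) \<and> X = {}} = {({}, {})}" using True by auto
    then show ?thesis using True by (simp add: matchings_0_1)
  next
    case False
    then obtain x where x: "x \<in> T" by blast
    let ?N = "\<lambda>T. card {(\<eta>, X). PB_pair T (\<eta>, X) \<and> X = {}}"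
    have smaller: "card (T - D) < card T" if "x \<in> D" for D
      using that x fin by (intro psubset_card_mono) auto
    have cl: "card {(\<eta>, X). PB_pair T (\<eta>, X) \<and> X = {} \<and> \<eta> `` {x} = {x, y} \<and> X \<inter> {x, y} = {}} = ?N (T - {x, y})"
      if "y \<in> T" for y
      using that x by (intro card_PB_pairs_with_class[OF fin]) (auto simp: card_insert_if)
    have unmarked: "{(\<eta>, X). PB_pair T (\<eta>, X) \<and> X = {} \<and> \<eta> `` {x} = {x} \<and> X \<inter> {x} = {x}} = {}"
      by auto
    have "(\<Sum>y\<in>T - {x}. card {(\<eta>, X). PB_pair T (\<eta>, X) \<and> X = {} \<and> \<eta> `` {x} = {x, y} \<and> X \<inter> {x, y} = {}}) =
        (\<Sum>y\<in>T - {x}. ?N (T - {x, y}))"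
      by (intro sum.cong refl cl) simp
    with cl[OF x] have "?N T = ?N (T - {x}) + (\<Sum>y\<in>T - {x}. ?N (T - {x, y}))"
      unfolding card_PB_pairs_split[OF fin x, of "\<lambda>\<eta> X. X = {}"] unmarked by simp
    also have "?N (T - {x}) = matchings (card T - 1)"
      using less.hyps[OF smaller[of "{x}"]] fin x by simp
    also have "(\<Sum>y\<in>T - {x}. ?N (T - {x, y})) = (\<Sum>y\<in>T - {x}. matchings (card T - 2))"
    proof (intro sum.cong refl)
      fix y assume "y \<in> T - {x}"
      then have "card (T - {x, y}) = card T - 2" using x by (subst card_Diff_subset) auto
      then show "?N (T - {x, y}) = matchings (card T - 2)"
        using less.hyps[OF smaller[of "{x, y}"]] fin by simp
    qed
    also have "\<dots> = (card T - 1) * matchings (card T - 2)" using x fin by simp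
    finally have *: "?N T = matchings (card T - 1) + (card T - 1) * matchings (card T - 2)" .
    have "card T \<noteq> 0" using x fin by auto
    then consider "card T = Suc 0" | m where "card T = Suc (Suc m)" by (metis not0_implies_Suc)
    then show ?thesis
    proof cases
      case 1
      then show ?thesis unfolding * by (simp add: matchings_0_1)
    next
      case 2
      then show ?thesis unfolding * by (simp add: matchings_Suc_Suc)
    qed
  qed
qed

lemma card_completions_0:
  assumes "finite T"
  shows "card (completions T \<epsilon> A 0) = matchings (card T)"
proof -
  have "finite X" if "PB_pair T (\<eta>, X)" for \<eta> X
    using PB_pair_subset(2)[OF that] assms finite_subset by blast
  then have "completions T \<epsilon> A 0 = {(\<eta>, X). PB_pair T (\<eta>, X) \<and> X = {}}"
    unfolding completions_def PB_rank_PB_join by auto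
  then show ?thesis using card_unmarked_PB_pairs[OF assms] by simp
qed

section \<open>The standard equivalence\<close>

text \<open>
  The points above \<open>k\<close> are grouped by \<open>(a - k - 1) div 2\<close>. Equal parity of \<open>k\<close> and \<open>n\<close>
  ensures that the last block is complete.
\<close>

lemma upper_block:
  fixes a k n :: nat
  assumes "k < a"
  defines "j \<equiv> (a - k - 1) div 2"
  shows "a = k + 2 * j + 1 \<or> a = k + 2 * j + 2"
    and "k \<le> n \<Longrightarrow> [k = n] (mod 2) \<Longrightarrow> a \<le> n \<Longrightarrow> k + 2 * j + 2 \<le> n"
proof -
  define b where "b = a - k - 1"
  have a: "a = k + b + 1" and j: "j = b div 2" using assms by (auto simp: b_def)
  have "b = 2 * j + b mod 2" "b mod 2 < 2" unfolding j by simp_all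
  then show "a = k + 2 * j + 1 \<or> a = k + 2 * j + 2" unfolding a by linarith
  assume "k \<le> n" "[k = n] (mod 2)" "a \<le> n"
  then have "2 dvd n - k" by (metis cong_sym cong_altdef_nat)
  then obtain m where "n - k = 2 * m" by (elim dvdE)
  then have n: "n = k + 2 * m" using \<open>k \<le> n\<close> by simp
  have "b < m * 2" using \<open>a \<le> n\<close> unfolding a n by simp
  then have "j < m" unfolding j by (rule less_mult_imp_div_less)
  then show "k + 2 * j + 2 \<le> n" unfolding n by simp
qed

text \<open>
  As the kernel of a function, the standard equivalence is visibly an equivalence relation, and
  its classes are fibres.
\<close>

lemma eps_eq_kernel:
  assumes "k \<le> n" "[k = n] (mod 2)"
  defines "f \<equiv> \<lambda>a. if a \<le> k then a else k + 1 + (a - k - 1) div 2"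
  shows "eps n k = {(a, b) \<in> {1..n} \<times> {1..n}. f a = f b}"
proof (intro equalityI subsetI)
  fix p assume "p \<in> eps n k"
  then show "p \<in> {(a, b) \<in> {1..n} \<times> {1..n}. f a = f b}"
    using assms(1) unfolding eps_def eps_classes_def f_def by auto
next
  fix p assume "p \<in> {(a, b) \<in> {1..n} \<times> {1..n}. f a = f b}"
  then obtain a b where p: "p = (a, b)" and ab: "a \<in> {1..n}" "b \<in> {1..n}" "f a = f b" by auto
  show "p \<in> eps n k"
  proof (cases "a \<le> k")
    case True
    then have "b = a" using ab(3) unfolding f_def by (auto split: if_splits)
    then have "\<exists>C \<in> {{i} | i. 1 \<le> i \<and> i \<le> k}. a \<in> C \<and> b \<in> C" using True ab(1) by auto
    then show ?thesis unfolding p eps_def eps_classes_def by blast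
  next
    case False
    define j where "j = (a - k - 1) div 2"
    have b: "\<not> b \<le> k" "(b - k - 1) div 2 = j"
      using ab(3) False unfolding f_def j_def by (auto split: if_splits)
    have "a \<in> {k + 2 * j + 1, k + 2 * j + 2}" "b \<in> {k + 2 * j + 1, k + 2 * j + 2}"
      using upper_block(1)[of k a] upper_block(1)[of k b] False b unfolding j_def by auto
    moreover have "k + 2 * j + 2 \<le> n"
      using upper_block(2)[of k a n] False ab(1) assms(1,2) unfolding j_def by auto
    ultimately show ?thesis unfolding p eps_def eps_classes_def by blast
  qed
qed

lemma eps_one_two_equiv:
  assumes "k \<le> n" "[k = n] (mod 2)"
  shows "one_two_equiv {1..n} (eps n k)" and "singletons {1..n} (eps n k) = {1..k}"
proof -
  define f where "f = (\<lambda>a. if a \<le> k then a else k + 1 + (a - k - 1) div 2)"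
  have e: "eps n k = {(a, b) \<in> {1..n} \<times> {1..n}. f a = f b}"
    unfolding f_def by (rule eps_eq_kernel[OF assms])
  have eq: "equiv {1..n} (eps n k)"
    unfolding e equiv_def refl_on_def sym_def trans_def by auto
  have small: "eps n k `` {a} = {a}" if "a \<in> {1..k}" for a
    using that assms(1) unfolding e f_def by auto
  have big: "eps n k `` {a} = {k + 2 * j + 1, k + 2 * j + 2}"
    if "a \<in> {1..n}" "\<not> a \<le> k" "j = (a - k - 1) div 2" for a j
  proof -
    have le: "k + 2 * j + 2 \<le> n" using upper_block(2)[of k a n] that assms by auto
    have fa: "f a = k + 1 + j" using that unfolding f_def by simp
    have fb: "f b = k + 1 + j \<longleftrightarrow> b = k + 2 * j + 1 \<or> b = k + 2 * j + 2" for b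
    proof (cases "b \<le> k")
      case False
      then show ?thesis using upper_block(1)[of k b] unfolding f_def by auto
    qed (simp add: f_def)
    have "eps n k `` {a} = {b \<in> {1..n}. f b = f a}"
      using that(1) unfolding e by force
    also have "\<dots> = {b \<in> {1..n}. b = k + 2 * j + 1 \<or> b = k + 2 * j + 2}"
      unfolding fa fb ..
    also have "\<dots> = {k + 2 * j + 1, k + 2 * j + 2}" using le by auto
    finally show ?thesis .
  qed
  show "one_two_equiv {1..n} (eps n k)"
  proof (subst one_two_equiv_iff; (intro conjI ballI eq)?)
    fix a assume a: "a \<in> {1..n}"
    show "card (eps n k `` {a}) \<le> 2"
    proof (cases "a \<le> k")
      case True
      then show ?thesis using small[of a] a by simp
    next
      case False
      then show ?thesis using big[OF a False refl] by simp
    qed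
  qed simp
  show "singletons {1..n} (eps n k) = {1..k}"
  proof (intro equalityI subsetI)
    fix a assume "a \<in> singletons {1..n} (eps n k)"
    then have a: "a \<in> {1..n}" "eps n k `` {a} = {a}" unfolding singletons_def by auto
    then have "a \<le> k" using big[of a] by force
    then show "a \<in> {1..k}" using a by simp
  next
    fix a assume "a \<in> {1..k}"
    then show "a \<in> singletons {1..n} (eps n k)"
      using small assms(1) unfolding singletons_def by auto
  qed
qed

lemma \<mu>_eq_card_completions:
  assumes "k \<le> n" "[k = n] (mod 2)" "r \<le> k"
  shows "PB_pair {1..n} (eps n k, {1..r})"
    and "\<mu> n k r q = card (completions {1..n} (eps n k) {1..r} q)"
proof -
  show PB: "PB_pair {1..n} (eps n k, {1..r})"
    unfolding PB_pair_iff using eps_one_two_equiv[OF assms(1,2)] assms(3) by auto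
  show "\<mu> n k r q = card (completions {1..n} (eps n k) {1..r} q)"
    using assms PB unfolding \<mu>_def completions_def by simp
qed

lemma \<mu>_undefined:
  assumes "\<not> (k \<le> n \<and> [k = n] (mod 2) \<and> r \<le> k)"
  shows "\<mu> n k r q = 0"
proof (cases "k \<le> n \<and> [k = n] (mod 2)")
  case True
  then have "\<not> PB_pair {1..n} (eps n k, {1..r})"
    unfolding PB_pair_iff using eps_one_two_equiv(2)[of k n] assms by auto
  then show ?thesis unfolding \<mu>_def by simp
next
  case False
  then show ?thesis unfolding \<mu>_def by auto
qed

section \<open>The count depends only on four cardinalities\<close>

text \<open>
  Both the given structure and the standard one with the same parameters satisfy
  \<open>completions_recurrence\<close>, and the induction hypothesis turns both right-hand sides into the
  same expression in \<open>\<mu>\<close>.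
\<close>

lemma card_completions_eq_\<mu>:
  fixes T :: "nat set"
  assumes "finite T" "PB_pair T (\<epsilon>, A)" "[card (singletons T \<epsilon>) = card T] (mod 2)"
  shows "card (completions T \<epsilon> A q) = \<mu> (card T) (card (singletons T \<epsilon>)) (card A) q"
  using assms
proof (induction "card T" arbitrary: T \<epsilon> A q rule: less_induct)
  case less
  let ?n = "card T" and ?k = "card (singletons T \<epsilon>)" and ?r = "card A"
  note fin = less.prems(1) and PB = less.prems(2) and par = less.prems(3)
  have AS: "A \<subseteq> singletons T \<epsilon>" using PB unfolding PB_pair_iff by blast
  have ST: "singletons T \<epsilon> \<subseteq> T" unfolding singletons_def by blast
  have fA: "finite A" using AS ST fin by (meson finite_subset)
  have kn: "?k \<le> ?n" using ST fin by (rule card_mono[rotated])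
  have rk: "?r \<le> ?k" using AS ST fin by (meson card_mono finite_subset)
  note std = \<mu>_eq_card_completions[OF kn par rk]
  have S: "singletons {1..?n} (eps ?n ?k) = {1..?k}" by (rule eps_one_two_equiv(2)[OF kn par])
  consider "q = 0" | "?r < q" | "q > 0" "?r > 0" by linarith
  then show ?case
  proof cases
    case 1
    then show ?thesis using std(2) fin by (simp add: card_completions_0)
  next
    case 2
    then show ?thesis
      using std(2) completions_empty[OF fin PB] completions_empty[OF _ std(1), of q] by simp
  next
    case 3
    have "A \<noteq> {}" using 3 by auto
    note L = completions_recurrence[OF fin PB this \<open>q > 0\<close> par, of \<mu>]
    have "{1..?r} \<noteq> {}" using 3 by simp
    note R = completions_recurrence[OF _ std(1) this \<open>q > 0\<close>, of \<mu>]
    show ?thesis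
      unfolding std(2) using L R less.hyps S par by simp
  qed
qed

theorem lemma4p3:
  fixes n k r q :: nat
  shows
    "(n \<ge> k \<and> k \<ge> r \<and> r \<ge> q \<and> q > 0 \<and> [n = k] (mod 2) \<longrightarrow>
        \<mu>\<^sub>Z (int n) (int k) (int r) (int q) =
            (int n - int k) * \<mu>\<^sub>Z (int n - 2) (int k) (int r) (int q)
          + \<mu>\<^sub>Z (int n - 1) (int k - 1) (int r - 1) (int q - 1)
          + \<mu>\<^sub>Z (int n - 1) (int k - 1) (int r - 1) (int q)
          + (int k - int r) * \<mu>\<^sub>Z (int n - 2) (int k - 2) (int r - 1) (int q)
          + (int r - 1) * \<mu>\<^sub>Z (int n - 2) (int k - 2) (int r - 2) (int q))
   \<and> (n \<ge> k \<and> k \<ge> r \<and> [n = k] (mod 2) \<longrightarrow>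
        \<mu> n k r 0 = (\<Sum>i = 0..n div 2. (n choose (2 * i)) * double_fact (2 * int i - 1)))
   \<and> (\<not> (n \<ge> k \<and> k \<ge> r \<and> r \<ge> q \<and> q > 0 \<and> [n = k] (mod 2)) \<and>
      \<not> (n \<ge> k \<and> k \<ge> r \<and> [n = k] (mod 2) \<and> q = 0) \<longrightarrow>
        \<mu> n k r q = 0)"
proof (intro conjI impI)
  assume "n \<ge> k \<and> k \<ge> r \<and> r \<ge> q \<and> q > 0 \<and> [n = k] (mod 2)"
  then have kn: "k \<le> n" and rk: "r \<le> k" and qr: "q \<le> r" "q > 0" and par: "[k = n] (mod 2)"
    by (auto simp: cong_sym_eq)
  note std = \<mu>_eq_card_completions[OF kn par rk]
  have ne: "{1..r} \<noteq> {}" using qr by simp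
  have rec: "\<mu> n k r q = (n - k) * \<mu> (n - 2) k r q + \<mu> (n - 1) (k - 1) (r - 1) (q - 1)
    + \<mu> (n - 1) (k - 1) (r - 1) q
    + (k - r) * \<mu> (n - 2) (k - 2) (r - 1) q + (r - 1) * \<mu> (n - 2) (k - 2) (r - 2) q"
    using completions_recurrence[OF _ std(1) ne \<open>q > 0\<close>, of \<mu>] card_completions_eq_\<mu>
      eps_one_two_equiv(2)[OF kn par] par std(2) by simp
  have Z: "\<mu>\<^sub>Z (int a) (int b) (int c) (int d) = int (\<mu> a b c d)" for a b c d
    unfolding \<mu>\<^sub>Z_def by simp
  \<comment> \<open>Each term with a possibly negative argument has coefficient \<open>0\<close> in that case, so truncated
     subtraction agrees with integer subtraction throughout.\<close>
  have "(int n - int k) * \<mu>\<^sub>Z (int n - 2) (int k) (int r) (int q) = int ((n - k) * \<mu> (n - 2) k r q)"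
  proof (cases "n = k")
    case False
    then have "int n - 2 = int (n - 2)" "int n - int k = int (n - k)"
      using kn par qr rk by auto
    then show ?thesis by (simp only: Z of_nat_mult)
  qed simp
  moreover have "\<mu>\<^sub>Z (int n - 1) (int k - 1) (int r - 1) (int q - 1) = int (\<mu> (n - 1) (k - 1) (r - 1) (q - 1))"
    "\<mu>\<^sub>Z (int n - 1) (int k - 1) (int r - 1) (int q) = int (\<mu> (n - 1) (k - 1) (r - 1) q)"
  proof -
    have "int n - 1 = int (n - 1)" "int k - 1 = int (k - 1)" "int r - 1 = int (r - 1)" "int q - 1 = int (q - 1)"
      using kn qr rk by auto
    then show "\<mu>\<^sub>Z (int n - 1) (int k - 1) (int r - 1) (int q - 1) = int (\<mu> (n - 1) (k - 1) (r - 1) (q - 1))"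
      "\<mu>\<^sub>Z (int n - 1) (int k - 1) (int r - 1) (int q) = int (\<mu> (n - 1) (k - 1) (r - 1) q)"
      by (simp_all only: Z)
  qed
  moreover have "(int k - int r) * \<mu>\<^sub>Z (int n - 2) (int k - 2) (int r - 1) (int q) =
    int ((k - r) * \<mu> (n - 2) (k - 2) (r - 1) q)"
  proof (cases "k = r")
    case False
    then have "int n - 2 = int (n - 2)" "int k - 2 = int (k - 2)" "int r - 1 = int (r - 1)"
      "int k - int r = int (k - r)"
      using kn qr rk by auto
    then show ?thesis by (simp only: Z of_nat_mult)
  qed simp
  moreover have "(int r - 1) * \<mu>\<^sub>Z (int n - 2) (int k - 2) (int r - 2) (int q) =
    int ((r - 1) * \<mu> (n - 2) (k - 2) (r - 2) q)"
  proof (cases "r = 1")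
    case False
    then have "int n - 2 = int (n - 2)" "int k - 2 = int (k - 2)" "int r - 2 = int (r - 2)"
      "int r - 1 = int (r - 1)"
      using kn qr rk by auto
    then show ?thesis by (simp only: Z of_nat_mult)
  qed simp
  ultimately show "\<mu>\<^sub>Z (int n) (int k) (int r) (int q) =
            (int n - int k) * \<mu>\<^sub>Z (int n - 2) (int k) (int r) (int q)
          + \<mu>\<^sub>Z (int n - 1) (int k - 1) (int r - 1) (int q - 1)
          + \<mu>\<^sub>Z (int n - 1) (int k - 1) (int r - 1) (int q)
          + (int k - int r) * \<mu>\<^sub>Z (int n - 2) (int k - 2) (int r - 1) (int q)
          + (int r - 1) * \<mu>\<^sub>Z (int n - 2) (int k - 2) (int r - 2) (int q)"
    unfolding Z rec by (simp only: of_nat_add)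
next
  assume "n \<ge> k \<and> k \<ge> r \<and> [n = k] (mod 2)"
  then have "k \<le> n" "[k = n] (mod 2)" "r \<le> k" by (auto simp: cong_sym_eq)
  from \<mu>_eq_card_completions(2)[OF this, of 0]
  show "\<mu> n k r 0 = (\<Sum>i = 0..n div 2. (n choose (2 * i)) * double_fact (2 * int i - 1))"
    by (simp add: card_completions_0 matchings_def)
next
  assume H: "\<not> (n \<ge> k \<and> k \<ge> r \<and> r \<ge> q \<and> q > 0 \<and> [n = k] (mod 2)) \<and>
      \<not> (n \<ge> k \<and> k \<ge> r \<and> [n = k] (mod 2) \<and> q = 0)"
  show "\<mu> n k r q = 0"
  proof (cases "k \<le> n \<and> [k = n] (mod 2) \<and> r \<le> k")
    case True
    then have kn: "k \<le> n" and par: "[k = n] (mod 2)" and rk: "r \<le> k" by blast+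
    have "r < q" using H True by (auto simp: cong_sym_eq)
    then show ?thesis
      using \<mu>_eq_card_completions[OF kn par rk] completions_empty[of "{1..n}" "eps n k" "{1..r}" q]
      by simp
  next
    case False
    then show ?thesis by (rule \<mu>_undefined)
  qed
qed

end
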